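(* Let $k,l\ge 0$ be integers. Let $r_1$ be a vertex of degree $2$ in the complete bipartite graph $K_{2,3}$. Let $(T,r_2)$ be the rooted starlike tree $\mathcal{R}(K_{1,l}^{(k)},r_2)$: the root $r_2$ is adjacent to $k$ vertices $u_1,\dots,u_k$, and each $u_i$ is additionally adjacent to $l$ further leaves (distinct for different $i$). Let $G$ be the coalescence of $(K_{2,3},r_1)$ and $(T,r_2)$. Then all roots of $\pi(G,x)$ are purely imaginary if and only if $l+k\ge 4$ and $l\le 2$.
   Context: For a finite simple graph $G$ with adjacency matrix $A(G)$, $\pi(G,x)=\operatorname{per}(xI-A(G))$ is its permanental polynomial, where $\operatorname{per}(M)=\sum_{\sigma\in S_n}\prod_i m_{i,\sigma(i)}$. The coalescence of rooted graphs $(G_1,r_1)$ and $(G_2,r_2)$ is obtained from their disjoint union by identifying $r_1$ with $r_2$. A complex number is purely imaginary if its real part is $0$ (including $0$). *)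

theory Defs
  imports
    Complex_Main
    "HOL-Combinatorics.Permutations"
    "HOL-Computational_Algebra.Polynomial"
    "Graph_Theory.Kuratowski"
begin

text \<open>
  A finite simple graph is a \<^locale>\<open>pair_graph\<close>: a finite vertex set with a finite, symmetric,
  irreflexive arc relation, each edge being represented by its two opposite arcs. Matrices are
  indexed by the vertices themselves, so no numbering of the vertices has to be chosen.
\<close>

definition permanent :: "'v set \<Rightarrow> ('v \<Rightarrow> 'v \<Rightarrow> 'c::comm_semiring_1) \<Rightarrow> 'c" where
  "permanent V M = (\<Sum>\<sigma> | \<sigma> permutes V. \<Prod>i\<in>V. M i (\<sigma> i))"

definition adjacency_matrix :: "'v pair_pre_digraph \<Rightarrow> 'v \<Rightarrow> 'v \<Rightarrow> complex" where
  "adjacency_matrix G u v = (if (u, v) \<in> parcs G then 1 else 0)"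

definition permanental_polynomial :: "'v pair_pre_digraph \<Rightarrow> complex poly" where
  "permanental_polynomial G =
     permanent (pverts G)
       (\<lambda>u v. (if u = v then [:0, 1:] else 0) - [:adjacency_matrix G u v:])"

definition purely_imaginary :: "complex \<Rightarrow> bool" where
  "purely_imaginary z \<longleftrightarrow> Re z = 0"

text \<open>
  The disjoint union lives on the sum type; the copy of \<open>r\<^sub>2\<close> is sent to the copy of \<open>r\<^sub>1\<close>, which
  represents the identified vertex.
\<close>

definition coalescence_inr :: "'a \<Rightarrow> 'b \<Rightarrow> 'b \<Rightarrow> 'a + 'b" where
  "coalescence_inr r\<^sub>1 r\<^sub>2 v = (if v = r\<^sub>2 then Inl r\<^sub>1 else Inr v)"

definition coalescence ::
  "'a pair_pre_digraph \<Rightarrow> 'a \<Rightarrow> 'b pair_pre_digraph \<Rightarrow> 'b \<Rightarrow> ('a + 'b) pair_pre_digraph" where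
  "coalescence G\<^sub>1 r\<^sub>1 G\<^sub>2 r\<^sub>2 =
     (let q = coalescence_inr r\<^sub>1 r\<^sub>2 in
      \<lparr> pverts = Inl ` pverts G\<^sub>1 \<union> q ` pverts G\<^sub>2,
        parcs = map_prod Inl Inl ` parcs G\<^sub>1 \<union> map_prod q q ` parcs G\<^sub>2 \<rparr>)"

text \<open>
  \<open>Mid i\<close> is the neighbour \<open>u\<^sub>i\<close> of the root, \<open>Leaf i j\<close> the \<open>j\<close>-th leaf attached to \<open>u\<^sub>i\<close>;
  indices start at 0.
\<close>

datatype starlike_vertex = Root | Mid nat | Leaf nat nat

definition starlike_tree :: "nat \<Rightarrow> nat \<Rightarrow> starlike_vertex pair_pre_digraph" where
  "starlike_tree k l = mk_symmetric
     \<lparr> pverts = {Root} \<union> {Mid i | i. i < k} \<union> {Leaf i j | i j. i < k \<and> j < l},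
       parcs = {(Root, Mid i) | i. i < k} \<union> {(Mid i, Leaf i j) | i j. i < k \<and> j < l} \<rparr>"

lemma pair_graph_starlike_tree: "pair_graph (starlike_tree k l)"
proof -
  let ?V = "{Root} \<union> {Mid i | i. i < k} \<union> {Leaf i j | i j. i < k \<and> j < l}"
  have *: "?V = {Root} \<union> Mid ` {..<k} \<union> (\<lambda>(i, j). Leaf i j) ` ({..<k} \<times> {..<l})"
    by auto
  have fin: "finite ?V"
    unfolding * by simp
  have sub: "parcs (starlike_tree k l) \<subseteq> ?V \<times> ?V"
    by (auto simp: starlike_tree_def mk_symmetric_def)
  have fin2: "finite (parcs (starlike_tree k l))"
    using finite_subset[OF sub] fin by blast
  have V: "pverts (starlike_tree k l) = ?V"
    by (simp add: starlike_tree_def mk_symmetric_def)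
  have sym: "sym (parcs (starlike_tree k l))"
    unfolding starlike_tree_def parcs_mk_symmetric sym_def by blast
  show ?thesis
  proof unfold_locales
    fix e assume e: "e \<in> parcs (starlike_tree k l)"
    show "fst e \<in> pverts (starlike_tree k l)" "snd e \<in> pverts (starlike_tree k l)"
      unfolding V using subsetD[OF sub e] by (auto simp: mem_Times_iff)
    show "fst e \<noteq> snd e"
      using e by (auto simp: starlike_tree_def mk_symmetric_def)
  next
    show "finite (pverts (starlike_tree k l))" unfolding V by (rule fin)
    show "finite (parcs (starlike_tree k l))" by (rule fin2)
    show "symmetric (with_proj (starlike_tree k l))"
      using sym by (simp add: symmetric_def)
  qed
qed

lemma pair_graph_coalescence:
  assumes "pair_graph G\<^sub>1" "pair_graph G\<^sub>2" "r\<^sub>1 \<in> pverts G\<^sub>1"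
  shows "pair_graph (coalescence G\<^sub>1 r\<^sub>1 G\<^sub>2 r\<^sub>2)"
proof -
  interpret A: pair_graph G\<^sub>1 by fact
  interpret B: pair_graph G\<^sub>2 by fact
  let ?q = "coalescence_inr r\<^sub>1 r\<^sub>2"
  let ?G = "coalescence G\<^sub>1 r\<^sub>1 G\<^sub>2 r\<^sub>2"
  have V: "pverts ?G = Inl ` pverts G\<^sub>1 \<union> ?q ` pverts G\<^sub>2"
    and E: "parcs ?G = map_prod Inl Inl ` parcs G\<^sub>1 \<union> map_prod ?q ?q ` parcs G\<^sub>2"
    by (simp_all add: coalescence_def Let_def)
  have inj: "?q u = ?q v \<longleftrightarrow> u = v" for u v
    by (auto simp: coalescence_inr_def)
  have s1: "(v, u) \<in> parcs G\<^sub>1" if "(u, v) \<in> parcs G\<^sub>1" for u v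
    using A.pair_sym_arcs that by (auto simp: symmetric_def sym_def)
  have s2: "(v, u) \<in> parcs G\<^sub>2" if "(u, v) \<in> parcs G\<^sub>2" for u v
    using B.pair_sym_arcs that by (auto simp: symmetric_def sym_def)
  show ?thesis
  proof unfold_locales
    fix e assume e: "e \<in> parcs ?G"
    show "fst e \<in> pverts ?G" "snd e \<in> pverts ?G"
      using e A.wellformed' B.wellformed' by (auto simp: V E)
    show "fst e \<noteq> snd e"
      using e A.pair_no_loops B.pair_no_loops by (fastforce simp: E inj)
  next
    show "finite (pverts ?G)"
      by (simp add: V A.pair_finite_verts B.pair_finite_verts)
    show "finite (parcs ?G)"
      by (simp add: E A.pair_finite_arcs B.pair_finite_arcs)
    show "symmetric (with_proj ?G)"
      by (force simp: symmetric_def sym_def E dest: s1 s2)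
  qed
qed

end

theory Submission
  imports Defs "HOL-Computational_Algebra.Fundamental_Theorem_Algebra"
begin

text \<open>
  Laplace expansion shows that a bridge \<open>ab\<close> between vertex sets \<open>A\<close> and \<open>B\<close> gives
  \<open>per (A \<union> B) = per A \<cdot> per B + per (A - a) \<cdot> per (B - b)\<close>. Peeling off the \<open>k\<close> stars \<open>K\<^sub>1\<^sub>,\<^sub>l\<close> one by one,
  with \<open>S\<close> the permanental polynomial of such a star, yields
  \<open>\<pi>(G, x) = x(x\<^sup>4 + 6x\<^sup>2 + 12) S\<^sup>k + k (x\<^sup>2 + 2)\<^sup>2 x\<^sup>l S\<^bsup>k-1\<^esup>\<close>. Since \<open>xS = x\<^sup>l (x\<^sup>2 + l)\<close>, for \<open>k > 0\<close> the only
  factor that matters is the cubic \<open>(y + l)(y\<^sup>2 + 6y + 12) + k(y + 2)\<^sup>2\<close> in \<open>y = x\<^sup>2\<close>, which must have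
  real roots only; nonpositivity is automatic. Substituting \<open>y = -2 - t\<close> turns it into
  \<open>t\<^sup>3 - (k + l)t\<^sup>2 + 2lt - 4(l - 2)\<close> up to sign. If \<open>l \<le> 2\<close> it has a root in \<open>[-2, 0]\<close>, and the remaining
  quadratic is nonpositive at \<open>t = 2\<close> as soon as \<open>k + l \<ge> 4\<close>. Conversely, if all roots are real,
  the Newton inequality \<open>e\<^sub>2\<^sup>2 \<ge> 3 e\<^sub>1 e\<^sub>3\<close> excludes \<open>l \<ge> 3\<close> and \<open>e\<^sub>1\<^sup>2 \<ge> 3 e\<^sub>2\<close> excludes \<open>l = 2, k = 1\<close>; for
  \<open>l \<le> 1\<close> and \<open>k + l \<le> 3\<close> the cubic is positive on \<open>t \<ge> 0\<close>, although its roots add up to \<open>k + l > 0\<close>.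
\<close>

section \<open>Permanents\<close>

lemma permanent_empty [simp]: "permanent {} M = 1"
  by (simp add: permanent_def)

lemma permanent_cong:
  assumes "\<And>i j. i \<in> V \<Longrightarrow> j \<in> V \<Longrightarrow> M i j = N i j"
  shows "permanent V M = permanent V N"
  unfolding permanent_def
  by (intro sum.cong prod.cong refl) (auto simp: assms permutes_in_image)

text \<open>Laplace expansion along row \<open>x\<close>. Deleting row \<open>x\<close> and column
  \<open>b\<close> leaves rows \<open>S\<close> but columns \<open>insert x S - {b}\<close>; to keep
  a single index set, the index \<open>b\<close> is reused for column \<open>x\<close>.\<close>

lemma permanent_insert:
  assumes "finite S" "x \<notin> S"
  shows "permanent (insert x S) M =
    M x x * permanent S M + (\<Sum>b\<in>S. M x b * permanent S (\<lambda>i j. M i (if j = b then x else j)))"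
proof -
  have row: "(\<Prod>i\<in>insert x S. M i ((transpose x b \<circ> q) i)) =
      M x b * (\<Prod>i\<in>S. M i (transpose x b (q i)))" if "q permutes S" for b q
    using assms that by (simp add: permutes_not_in)
  have "permanent (insert x S) M =
      (\<Sum>b\<in>insert x S. \<Sum>q | q permutes S. M x b * (\<Prod>i\<in>S. M i (transpose x b (q i))))"
    unfolding permanent_def sum_over_permutations_insert[OF assms]
    by (intro sum.cong refl row) simp
  also have "\<dots> = (\<Sum>b\<in>insert x S. M x b * permanent S (\<lambda>i j. M i (transpose x b j)))"
    by (simp add: permanent_def sum_distrib_left)
  also have "\<dots> = M x x * permanent S M + (\<Sum>b\<in>S. M x b * permanent S (\<lambda>i j. M i (transpose x b j)))"
    using assms by simp
  also have "(\<Sum>b\<in>S. M x b * permanent S (\<lambda>i j. M i (transpose x b j))) =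
      (\<Sum>b\<in>S. M x b * permanent S (\<lambda>i j. M i (if j = b then x else j)))"
    using assms
    by (intro sum.cong refl arg_cong2[where f = "(*)"] permanent_cong)
       (auto simp: transpose_def)
  finally show ?thesis .
qed

lemma permanent_zero_column:
  assumes "finite S" "d \<in> S" "\<And>i. i \<in> S \<Longrightarrow> M i d = 0"
  shows "permanent S M = 0"
  unfolding permanent_def
proof (rule sum.neutral, clarify)
  fix p assume p: "p permutes S"
  have "inv p d \<in> S" "p (inv p d) = d"
    using p assms(2) by (simp_all add: permutes_inv permutes_in_image permutes_inverses)
  then show "(\<Prod>i\<in>S. M i (p i)) = 0"
    using assms by (intro prod_zero) force+
qed

text \<open>Expanding along the rows of \<open>A\<close> never picks a column in \<open>B\<close>.
  The one-sided hypothesis matters: the relabelled minors in \<open>permanent_bridge\<close> are in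
  general not block diagonal.\<close>

lemma permanent_block_triangular:
  assumes "finite A" "finite B" "A \<inter> B = {}" "\<And>i j. i \<in> A \<Longrightarrow> j \<in> B \<Longrightarrow> M i j = 0"
  shows "permanent (A \<union> B) M = permanent A M * permanent B M"
  using assms
proof (induction A arbitrary: M rule: finite_induct)
  case (insert x A)
  let ?c = "\<lambda>b i j. M i (if j = b then x else j)"
  have x: "x \<notin> A \<union> B" "x \<notin> B" using insert by auto
  have col: "permanent (A \<union> B) (?c b) = permanent A (?c b) * permanent B M" if "b \<in> A" for b
  proof -
    have "permanent (A \<union> B) (?c b) = permanent A (?c b) * permanent B (?c b)"
      using insert that by (intro insert.IH) auto
    also have "permanent B (?c b) = permanent B M"
      using that insert by (intro permanent_cong) auto
    finally show ?thesis .
  qed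
  have diag: "permanent (A \<union> B) M = permanent A M * permanent B M"
    using insert by (intro insert.IH) auto
  have "permanent (insert x A \<union> B) M =
      M x x * permanent (A \<union> B) M + (\<Sum>b\<in>A \<union> B. M x b * permanent (A \<union> B) (?c b))"
    unfolding Un_insert_left using insert x by (intro permanent_insert) auto
  also have "(\<Sum>b\<in>A \<union> B. M x b * permanent (A \<union> B) (?c b)) =
      (\<Sum>b\<in>A. M x b * permanent (A \<union> B) (?c b))"
    using insert by (intro sum.mono_neutral_right) auto
  also have "\<dots> = (\<Sum>b\<in>A. M x b * permanent A (?c b)) * permanent B M"
    by (simp add: col sum_distrib_right mult.assoc)
  also have "M x x * permanent (A \<union> B) M + \<dots> = permanent (insert x A) M * permanent B M"
    unfolding permanent_insert[OF insert.hyps] diag by (simp only: distrib_right mult.assoc)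
  finally show ?case .
qed simp

text \<open>Expand along row \<open>a\<close>. The columns in \<open>A\<close> assemble to the first
  product; the only other column that counts is \<open>b\<close>, and its minor gives the
  second.\<close>

lemma permanent_bridge:
  assumes "finite A" "finite B" "A \<inter> B = {}" "a \<in> A" "b \<in> B"
    and AB: "\<And>i j. i \<in> A \<Longrightarrow> j \<in> B \<Longrightarrow> (i, j) \<noteq> (a, b) \<Longrightarrow> M i j = 0"
    and BA: "\<And>i j. i \<in> B \<Longrightarrow> j \<in> A \<Longrightarrow> (i, j) \<noteq> (b, a) \<Longrightarrow> M i j = 0"
  shows "permanent (A \<union> B) M = permanent A M * permanent B M
    + M a b * M b a * permanent (A - {a}) M * permanent (B - {b}) M"
proof -
  define A' B' where "A' = A - {a}" and "B' = B - {b}"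
  have A: "A = insert a A'" "a \<notin> A'" "a \<notin> B" "finite A'" "A' \<inter> B = {}"
    and B: "B = insert b B'" "b \<notin> B'" "b \<notin> A'" "finite B'" "A' \<inter> B' = {}"
    using assms by (auto simp: A'_def B'_def)
  have mem: "i \<in> A" if "i \<in> A'" for i using that by (simp add: A'_def)
  have mem': "i \<in> B" if "i \<in> B'" for i using that by (simp add: B'_def)
  let ?c = "\<lambda>b i j. M i (if j = b then a else j)"
  have diag: "permanent (A' \<union> B) M = permanent A' M * permanent B M"
    using A(2-5) assms(2,4,5) by (intro permanent_block_triangular AB) (auto dest: mem)
  have col: "permanent (A' \<union> B) (?c d) = permanent A' (?c d) * permanent B M" if "d \<in> A'" for d
  proof -
    have "permanent (A' \<union> B) (?c d) = permanent A' (?c d) * permanent B (?c d)"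
      using A(2-5) B(2-5) assms(2,4,5) that by (intro permanent_block_triangular) (auto intro!: AB dest: mem mem')
    also have "permanent B (?c d) = permanent B M"
      using that A(5) by (intro permanent_cong) auto
    finally show ?thesis .
  qed
  \<comment> \<open>Index \<open>b\<close> now carries column \<open>a\<close> of \<open>M\<close>,
    which on the rows \<open>B\<close> vanishes outside row \<open>b\<close>; expanding along row
    \<open>b\<close> therefore leaves one term.\<close>
  have minor: "permanent B (?c b) = M b a * permanent B' M"
  proof -
    have "permanent B (?c b) = M b a * permanent B' (?c b)
      + (\<Sum>d\<in>B'. ?c b b d * permanent B' (\<lambda>i j. ?c b i (if j = d then b else j)))"
      unfolding B(1) using B(2-5) by (subst permanent_insert) auto
    also have "(\<Sum>d\<in>B'. ?c b b d * permanent B' (\<lambda>i j. ?c b i (if j = d then b else j))) = 0"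
    proof (rule sum.neutral, rule ballI)
      fix d assume "d \<in> B'"
      then have "permanent B' (\<lambda>i j. ?c b i (if j = d then b else j)) = 0"
        using A(2-5) B(2-5) assms(4,5) by (intro permanent_zero_column[of B' d]) (auto intro!: BA dest: mem mem')
      then show "?c b b d * permanent B' (\<lambda>i j. ?c b i (if j = d then b else j)) = 0"
        by simp
    qed
    also have "permanent B' (?c b) = permanent B' M"
      using B(2-5) by (intro permanent_cong) auto
    finally show ?thesis by simp
  qed
  have swap: "permanent (A' \<union> B) (?c b) = permanent A' M * (M b a * permanent B' M)"
  proof -
    \<comment> \<open>The blocks exchange roles: rows in \<open>B\<close> vanish on
      \<open>A'\<close>, while rows in \<open>A'\<close> may be nonzero at index \<open>b\<close>,
      which carries column \<open>a\<close>.\<close>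
    have "permanent (B \<union> A') (?c b) = permanent B (?c b) * permanent A' (?c b)"
      using A(2-5) B(2-5) assms(2,4,5) by (intro permanent_block_triangular) (auto intro!: BA dest: mem mem')
    also have "permanent A' (?c b) = permanent A' M"
      using B(2-5) by (intro permanent_cong) auto
    finally show ?thesis by (simp add: minor Un_commute mult.commute)
  qed
  have "permanent (A \<union> B) M =
      M a a * permanent (A' \<union> B) M + (\<Sum>d\<in>A' \<union> B. M a d * permanent (A' \<union> B) (?c d))"
    unfolding A(1) Un_insert_left using A(2-5) assms(2,4,5) by (intro permanent_insert) auto
  also have "(\<Sum>d\<in>A' \<union> B. M a d * permanent (A' \<union> B) (?c d)) =
      (\<Sum>d\<in>insert b A'. M a d * permanent (A' \<union> B) (?c d))"
    using A(4,5) assms(2,5) AB[OF assms(4)] by (intro sum.mono_neutral_right) auto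
  also have "\<dots> = M a b * permanent (A' \<union> B) (?c b)
      + (\<Sum>d\<in>A'. M a d * permanent A' (?c d)) * permanent B M"
    using A(2-5) B(2-5) by (simp add: col sum_distrib_right mult.assoc)
  also have "M a a * permanent (A' \<union> B) M + \<dots> =
      permanent A M * permanent B M + M a b * M b a * permanent A' M * permanent B' M"
    unfolding A(1) permanent_insert[OF A(4,2)] diag swap
    by (simp only: distrib_left distrib_right add_ac mult_ac)
  finally show ?thesis by (simp add: A'_def B'_def)
qed

lemma poly_permanent:
  "poly (permanent V M) z = permanent V (\<lambda>u v. poly (M u v) z)"
  by (simp add: permanent_def poly_sum poly_prod)

section \<open>The permanental polynomial of the coalescence\<close>

lemma permanent_singleton [simp]: "permanent {x} M = M x x"
  using permanent_insert[of "{}" x M] by simp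

lemma permanent_diagonal:
  assumes "finite S" "\<And>i j. i \<in> S \<Longrightarrow> j \<in> S \<Longrightarrow> i \<noteq> j \<Longrightarrow> M i j = 0"
  shows "permanent S M = (\<Prod>i\<in>S. M i i)"
  using assms
proof (induction S rule: finite_induct)
  case (insert x S)
  have "permanent ({x} \<union> S) M = permanent {x} M * permanent S M"
    using insert by (intro permanent_block_triangular) auto
  then show ?case using insert by simp
qed simp

section \<open>Matrix entries and vertex set of the coalescence\<close>

definition charmat :: "'v pair_pre_digraph \<Rightarrow> complex \<Rightarrow> 'v \<Rightarrow> 'v \<Rightarrow> complex" where
  "charmat G z u v = (if u = v then z else 0) - adjacency_matrix G u v"

lemma poly_permanental_polynomial:
  "poly (permanental_polynomial G) z = permanent (pverts G) (charmat G z)"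
  unfolding permanental_polynomial_def poly_permanent
  by (rule permanent_cong) (simp add: charmat_def)

lemma parcs_starlike_tree:
  "(u, v) \<in> parcs (starlike_tree k l) \<longleftrightarrow>
    (\<exists>i<k. u = Root \<and> v = Mid i \<or> u = Mid i \<and> v = Root \<or>
      (\<exists>j<l. u = Mid i \<and> v = Leaf i j \<or> u = Leaf i j \<and> v = Mid i))"
proof -
  have sym: "(u, v) \<in> parcs (mk_symmetric G) \<longleftrightarrow> (u, v) \<in> parcs G \<or> (v, u) \<in> parcs G"
    for G :: "starlike_vertex pair_pre_digraph"
    unfolding parcs_mk_symmetric by (auto intro: bexI[of _ "(v, u)"])
  show ?thesis
    unfolding starlike_tree_def sym by auto
qed

text \<open>One rule per pair of constructors makes matrix entries computable by simplification.
  \<open>Inr Root\<close> is in no arc, because \<open>Root\<close> is merged into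
  \<open>Inl r\<close>.\<close>

lemma parcs_coalescence_starlike:
  fixes H :: "'a pair_pre_digraph" and r :: 'a and k l :: nat
  defines "G \<equiv> coalescence H r (starlike_tree k l) Root"
  shows "(Inl a, Inl b) \<in> parcs G \<longleftrightarrow> (a, b) \<in> parcs H"
    and "(Inl a, Inr v) \<in> parcs G \<longleftrightarrow> a = r \<and> (\<exists>i<k. v = Mid i)"
    and "(Inr v, Inl a) \<in> parcs G \<longleftrightarrow> a = r \<and> (\<exists>i<k. v = Mid i)"
    and "(Inr u, Inr v) \<in> parcs G \<longleftrightarrow>
      (\<exists>i<k. \<exists>j<l. u = Mid i \<and> v = Leaf i j \<or> u = Leaf i j \<and> v = Mid i)"
proof -
  have G: "(x, y) \<in> parcs G \<longleftrightarrow> (\<exists>a b. x = Inl a \<and> y = Inl b \<and> (a, b) \<in> parcs H) \<or>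
    (\<exists>u v. x = coalescence_inr r Root u \<and> y = coalescence_inr r Root v \<and>
      (u, v) \<in> parcs (starlike_tree k l))" for x y
    unfolding G_def coalescence_def Let_def by force
  show "(Inl a, Inl b) \<in> parcs G \<longleftrightarrow> (a, b) \<in> parcs H"
    and "(Inl a, Inr v) \<in> parcs G \<longleftrightarrow> a = r \<and> (\<exists>i<k. v = Mid i)"
    and "(Inr v, Inl a) \<in> parcs G \<longleftrightarrow> a = r \<and> (\<exists>i<k. v = Mid i)"
    and "(Inr u, Inr v) \<in> parcs G \<longleftrightarrow>
      (\<exists>i<k. \<exists>j<l. u = Mid i \<and> v = Leaf i j \<or> u = Leaf i j \<and> v = Mid i)"
    unfolding G parcs_starlike_tree by (auto simp: coalescence_inr_def)
qed

lemmas charmat_simps = charmat_def adjacency_matrix_def parcs_coalescence_starlike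

definition leaves :: "nat \<Rightarrow> nat \<Rightarrow> ('a + starlike_vertex) set" where
  "leaves i l = (\<lambda>j. Inr (Leaf i j)) ` {..<l}"

text \<open>The number of leaves is an argument so that a star can be built up leaf by leaf inside
  the fixed graph.\<close>

definition branch :: "nat \<Rightarrow> nat \<Rightarrow> ('a + starlike_vertex) set" where
  "branch i l = insert (Inr (Mid i)) (leaves i l)"

lemma finite_leaves [simp]: "finite (leaves i l)"
  and finite_branch [simp]: "finite (branch i l)"
  by (simp_all add: branch_def leaves_def)

lemma pverts_coalescence_starlike:
  assumes "r \<in> pverts H"
  shows "pverts (coalescence H r (starlike_tree k l) Root) =
    Inl ` pverts H \<union> (\<Union>i<k. branch i l)"
  using assms
  by (auto simp: coalescence_def Let_def coalescence_inr_def starlike_tree_def branch_def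
      leaves_def image_iff)

text \<open>For \<open>l = 0\<close> the truncated exponent \<open>l - 1\<close> is harmless because its coefficient vanishes.\<close>

definition star_value :: "nat \<Rightarrow> 'c::comm_semiring_1 \<Rightarrow> 'c" where
  "star_value l z = z ^ (l + 1) + of_nat l * z ^ (l - 1)"

text \<open>The extra factor \<open>z\<close> clears the truncated exponent and exposes the possible
  zeros of \<open>star_value\<close>.\<close>

lemma star_value_mult: "z * star_value l z = z ^ l * (z\<^sup>2 + of_nat l)"
  by (cases l) (simp_all add: star_value_def power2_eq_square algebra_simps)

section \<open>Peeling off the branches\<close>

context
  fixes H :: "'a pair_pre_digraph" and r :: 'a and k l :: nat and z :: complex
    and M :: "'a + starlike_vertex \<Rightarrow> 'a + starlike_vertex \<Rightarrow> complex"
  defines "M \<equiv> charmat (coalescence H r (starlike_tree k l) Root) z"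
begin

lemma permanent_leaves:
  assumes "i < k" "m \<le> l"
  shows "permanent (leaves i m) M = z ^ m"
proof -
  have "permanent (leaves i m) M = (\<Prod>v\<in>leaves i m. M v v)"
    by (rule permanent_diagonal) (auto simp: M_def charmat_simps leaves_def)
  also have "\<dots> = (\<Prod>j<m. z)"
    unfolding leaves_def by (subst prod.reindex) (auto simp: inj_on_def M_def charmat_simps)
  finally show ?thesis by simp
qed

text \<open>Each new leaf hangs on a bridge, so the value for \<open>m + 1\<close> leaves is
  \<open>z\<close> times the value for \<open>m\<close>, plus \<open>z ^ m\<close> from the leaves
  isolated by deleting the centre.\<close>

lemma permanent_branch:
  assumes "i < k" "m \<le> l"
  shows "permanent (branch i m) M = star_value m z"
  using assms(2)
proof (induction m)
  case 0
  then show ?case by (simp add: branch_def leaves_def star_value_def M_def charmat_simps)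
next
  case (Suc m)
  let ?u = "Inr (Mid i)" and ?w = "Inr (Leaf i m)"
  have split: "branch i (Suc m) = branch i m \<union> {?w}"
    by (auto simp: branch_def leaves_def lessThan_Suc)
  have "permanent (branch i m \<union> {?w}) M = permanent (branch i m) M * permanent {?w} M
      + M ?u ?w * M ?w ?u * permanent (branch i m - {?u}) M * permanent ({?w} - {?w}) M"
    by (rule permanent_bridge) (auto simp: branch_def leaves_def M_def charmat_simps)
  also have "branch i m - {?u} = leaves i m"
    by (auto simp: branch_def leaves_def)
  also have "M ?u ?w * M ?w ?u = 1"
    using Suc assms(1) by (simp add: M_def charmat_simps)
  also have "permanent {?w} M = z"
    by (simp add: M_def charmat_simps)
  also have "permanent (branch i m) M = star_value m z"
    using Suc by simp
  also have "permanent (leaves i m) M = z ^ m"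
    using Suc assms(1) by (simp add: permanent_leaves)
  finally have "permanent (branch i (Suc m)) M = star_value m z * z + z ^ m"
    unfolding split by simp
  also have "\<dots> = star_value (Suc m) z"
    unfolding mult.commute[of _ z] star_value_mult
    by (simp add: star_value_def power2_eq_square algebra_simps)
  finally show ?case .
qed

lemma permanent_branches_detached:
  assumes "finite X" "r \<notin> X" "n \<le> k"
  shows "permanent (Inl ` X \<union> (\<Union>i<n. branch i l)) M = permanent (Inl ` X) M * star_value l z ^ n"
  using assms(3)
proof (induction n)
  case (Suc n)
  have "permanent ((Inl ` X \<union> (\<Union>i<n. branch i l)) \<union> branch n l) M =
      permanent (Inl ` X \<union> (\<Union>i<n. branch i l)) M * permanent (branch n l) M"
    using assms by (intro permanent_block_triangular)
      (auto simp: branch_def leaves_def M_def charmat_simps)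
  then show ?case
    using Suc by (simp add: permanent_branch lessThan_Suc Un_ac mult_ac)
qed simp

text \<open>Branch \<open>n\<close> hangs on the bridge from \<open>r\<close> to
  \<open>Mid n\<close>. Cutting out both ends leaves \<open>l\<close> isolated leaves and, without
  \<open>r\<close>, the detached situation of the previous lemma.\<close>

lemma permanent_branches_attached:
  assumes "finite X" "r \<in> X" "n \<le> k"
  shows "permanent (Inl ` X \<union> (\<Union>i<n. branch i l)) M =
    permanent (Inl ` X) M * star_value l z ^ n
    + of_nat n * permanent (Inl ` (X - {r})) M * star_value l z ^ (n - 1) * z ^ l"
  using assms(3)
proof (induction n)
  case (Suc n)
  let ?U = "\<Union>i<n. branch i l :: ('a + starlike_vertex) set" and ?u = "Inr (Mid n)"
  have "permanent ((Inl ` X \<union> ?U) \<union> branch n l) M =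
      permanent (Inl ` X \<union> ?U) M * permanent (branch n l) M
      + M (Inl r) ?u * M ?u (Inl r) * permanent (Inl ` X \<union> ?U - {Inl r}) M
        * permanent (branch n l - {?u}) M"
    using assms by (intro permanent_bridge)
      (auto simp: branch_def leaves_def M_def charmat_simps)
  also have "Inl ` X \<union> ?U - {Inl r} = Inl ` (X - {r}) \<union> ?U"
    by (auto simp: branch_def leaves_def)
  also have "branch n l - {?u} = leaves n l"
    by (auto simp: branch_def leaves_def)
  also have "M (Inl r) ?u * M ?u (Inl r) = 1"
    using Suc by (simp add: M_def charmat_simps)
  also have "permanent (Inl ` (X - {r}) \<union> ?U) M =
      permanent (Inl ` (X - {r})) M * star_value l z ^ n"
    using Suc assms by (intro permanent_branches_detached) auto
  also have "permanent (branch n l) M = star_value l z"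
    using Suc by (simp add: permanent_branch)
  also have "permanent (leaves n l) M = z ^ l"
    using Suc by (simp add: permanent_leaves)
  also have "permanent (Inl ` X \<union> ?U) M = permanent (Inl ` X) M * star_value l z ^ n
    + of_nat n * permanent (Inl ` (X - {r})) M * star_value l z ^ (n - 1) * z ^ l"
    using Suc by simp
  finally have "permanent ((Inl ` X \<union> ?U) \<union> branch n l) M =
    permanent (Inl ` X) M * star_value l z ^ Suc n
    + (of_nat n * (star_value l z ^ (n - 1) * star_value l z) + star_value l z ^ n)
      * permanent (Inl ` (X - {r})) M * z ^ l"
    by (simp add: algebra_simps)
  \<comment> \<open>For \<open>n = 0\<close> the exponent \<open>n - 1\<close> truncates, but the
    coefficient vanishes.\<close>
  also have "of_nat n * (star_value l z ^ (n - 1) * star_value l z) = of_nat n * star_value l z ^ n"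
    by (cases n) simp_all
  finally show ?case
    by (simp add: lessThan_Suc Un_ac algebra_simps)
qed simp

end

text \<open>The matrix is small enough for full expansion. As a check, 6 counts the edges, 12 is 6
  two-edge matchings plus 2 for each of the 3 four-cycles, and deleting \<open>r\<close> leaves a
  four-cycle.\<close>

lemma permanent_K23:
  fixes z :: "'c::comm_ring_1"
  assumes "distinct [r, b, c, p, q]"
    and "\<And>u v. u \<in> {r, b, c, p, q} \<Longrightarrow> v \<in> {r, b, c, p, q} \<Longrightarrow>
      N u v = (if u = v then z else if u \<in> {p, q} \<longleftrightarrow> v \<in> {p, q} then 0 else - 1)"
  shows "permanent {r, b, c, p, q} N = z * (z ^ 4 + 6 * z\<^sup>2 + 12)"
    and "permanent {b, c, p, q} N = (z\<^sup>2 + 2)\<^sup>2"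
proof -
  \<comment> \<open>The reversed list provides every inequality with its sides swapped, for the
    simplifier.\<close>
  have "distinct [q, p, c, b, r]" using assms(1) by auto
  note simps = this assms permanent_insert eval_nat_numeral algebra_simps
  show "permanent {b, c, p, q} N = (z\<^sup>2 + 2)\<^sup>2"
    by (use simps(1-2) in \<open>simp add: simps(3-)\<close>)
  show "permanent {r, b, c, p, q} N = z * (z ^ 4 + 6 * z\<^sup>2 + 12)"
    by (use simps(1-2) in \<open>simp add: simps(3-)\<close>)
qed

section \<open>The cubic factor\<close>

definition cubic_factor :: "nat \<Rightarrow> nat \<Rightarrow> 'c::comm_semiring_1 \<Rightarrow> 'c" where
  "cubic_factor k l y = (y + of_nat l) * (y\<^sup>2 + 6 * y + 12) + of_nat k * (y + 2)\<^sup>2"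

text \<open>A nonreal root comes with its conjugate, so at real \<open>s\<close> the quadratic would
  equal \<open>(s - Re w)^2 + (Im w)^2 > 0\<close>.\<close>

lemma real_of_quadratic_nonpos:
  fixes p q s :: real and w :: complex
  assumes "w\<^sup>2 + of_real p * w + of_real q = 0" "s\<^sup>2 + p * s + q \<le> 0"
  shows "Im w = 0"
proof (rule ccontr)
  assume "Im w \<noteq> 0"
  have re: "(Re w)\<^sup>2 - (Im w)\<^sup>2 + p * Re w + q = 0" and "Im w * (2 * Re w + p) = 0"
    using assms(1) by (simp_all add: complex_eq_iff power2_eq_square algebra_simps)
  with \<open>Im w \<noteq> 0\<close> have p: "p = - 2 * Re w" by simp
  have "(s - Re w)\<^sup>2 + (Im w)\<^sup>2 \<le> 0"
    using re assms(2) unfolding p by (simp add: power2_eq_square algebra_simps)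
  with \<open>Im w \<noteq> 0\<close> show False
    by (metis add_nonneg_pos not_less zero_le_power2 zero_less_power2)
qed

lemma Re_zero_of_square:
  assumes "z\<^sup>2 = of_real y" "y \<le> 0"
  shows "Re z = 0"
proof (rule ccontr)
  assume "Re z \<noteq> 0"
  have "(Re z)\<^sup>2 - (Im z)\<^sup>2 = y" "Re z * Im z = 0"
    using assms(1) by (auto simp: complex_eq_iff power2_eq_square)
  with \<open>Re z \<noteq> 0\<close> have "(Re z)\<^sup>2 = y" by simp
  with \<open>Re z \<noteq> 0\<close> assms(2) show False by (metis not_less zero_less_power2)
qed

text \<open>Stated as an identity in \<open>x\<close> so that multiplicities are kept, as Vieta's
  relations require.\<close>

lemma cubic_factorization:
  fixes b c d :: complex
  obtains r s t where "\<And>x. x ^ 3 + b * x\<^sup>2 + c * x + d = (x - r) * (x - s) * (x - t)"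
proof -
  have "\<exists>r. poly [:d, c, b, 1:] r = 0"
    by (rule fundamental_theorem_of_algebra_alt) auto
  then obtain r where r: "d = - (r * (c + r * (b + r)))"
    by (auto simp: eq_neg_iff_add_eq_0)
  \<comment> \<open>These are the coefficients of the quotient by \<open>x - r\<close>, from
    Horner's scheme.\<close>
  have "\<exists>s. poly [:c + r * (b + r), b + r, 1:] s = 0"
    by (rule fundamental_theorem_of_algebra_alt) auto
  then obtain s where "c + r * (b + r) + s * (b + r + s) = 0" by auto
  then have c: "c = - (r * (b + r)) - s * (b + r + s)" by algebra
  show ?thesis
  proof
    show "x ^ 3 + b * x\<^sup>2 + c * x + d = (x - r) * (x - s) * (x - (- b - r - s))" for x
      unfolding r c by algebra
  qed
qed

text \<open>Centring at -2 turns the term with \<open>k\<close> into a multiple of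
  \<open>t^2\<close> and \<open>y^2 + 6y + 12\<close> into \<open>t^2 - 2t + 4\<close>.\<close>

lemma cubic_factor_eq_cubic:
  fixes t :: "'c::comm_ring_1"
  shows "cubic_factor k l (- 2 - t) =
    - (t ^ 3 - (of_nat k + of_nat l) * t\<^sup>2 + 2 * of_nat l * t - 4 * (of_nat l - 2))"
  by (simp add: cubic_factor_def power2_eq_square power3_eq_cube algebra_simps)

lemma cubic_factor_root_nonpos:
  fixes w :: complex
  assumes "cubic_factor k l w = 0" "l + k \<ge> 4" "l \<le> 2"
  obtains y :: real where "w = of_real y" "y \<le> 0"
proof -
  define e :: real where "e = real k + real l"
  define g where "g t = t ^ 3 - e * t\<^sup>2 + 2 * real l * t - 4 * (real l - 2)" for t
  have e: "e \<ge> 4" using assms(2) by (simp add: e_def)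
  have l: "real l \<le> 2" using assms(3) by simp
  have g: "g (-2) \<le> 0" "0 \<le> g 0" using e l by (auto simp: g_def power2_eq_square)
  \<comment> \<open>Here \<open>g (-2) = -4e - 8l\<close> and \<open>g 0 = 8 - 4l\<close>; the
    latter is where \<open>l\<close> at most 2 enters.\<close>
  have "\<exists>a. -2 \<le> a \<and> a \<le> 0 \<and> g a = 0"
    using g by (intro IVT[of g "-2" 0 0]) (auto simp: g_def [abs_def] intro!: continuous_intros)
  then obtain a where a: "-2 \<le> a" "a \<le> 0" "g a = 0" by auto
  define p q where "p = a - e" and "q = 2 * real l + a * p"
  have fac: "g t = (t - a) * (t\<^sup>2 + p * t + q)" for t
    using a(3) unfolding g_def p_def q_def by algebra
  \<comment> \<open>At 2 the terms in \<open>l\<close> cancel and \<open>g 2 = 16 - 4e\<close>.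
    Since \<open>2 - a > 0\<close>, the quadratic factor inherits the sign.\<close>
  have "g 2 \<le> 0" using e by (simp add: g_def e_def)
  then have at2: "2\<^sup>2 + p * 2 + q \<le> 0"
    using a fac[of 2] by (simp add: mult_le_0_iff)
  define t where "t = - 2 - w"
  have w: "w = - 2 - t" by (simp add: t_def)
  have cfac: "- cubic_factor k l w = (t - of_real a) * (t\<^sup>2 + of_real p * t + of_real q)"
  proof -
    have "of_real a ^ 3 - of_real e * of_real a ^ 2 + 2 * of_nat l * of_real a
        - 4 * (of_nat l - 2) = (of_real (g a) :: complex)"
      by (simp add: g_def)
    also have "\<dots> = 0" by (simp add: a)
    finally have "of_real a ^ 3 - of_real e * of_real a ^ 2 + 2 * of_nat l * of_real a
        - 4 * (of_nat l - 2) = (0 :: complex)" .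
    moreover have "of_nat k + of_nat l = (of_real e :: complex)" by (simp add: e_def)
    moreover have "of_real p = (of_real a - of_real e :: complex)"
      and "of_real q = (2 * of_nat l + of_real a * of_real p :: complex)"
      by (simp_all add: p_def q_def)
    ultimately show ?thesis unfolding w cubic_factor_eq_cubic by algebra
  qed
  have "Im t = 0"
    using cfac assms(1) real_of_quadratic_nonpos[OF _ at2, of t] by auto
  then have y: "w = of_real (Re w)" by (simp add: w complex_eq_iff)
  have "Re w \<le> 0"
  proof (rule ccontr)
    assume "\<not> Re w \<le> 0"
    \<comment> \<open>At a positive argument the first summand is positive and the second
      nonnegative.\<close>
    then have "cubic_factor k l (Re w) > 0"
      unfolding cubic_factor_def
      by (cases "k = 0") (auto intro!: add_nonneg_pos add_pos_nonneg mult_pos_pos)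
    moreover have "of_real (cubic_factor k l (Re w)) = cubic_factor k l (of_real (Re w) :: complex)"
      by (simp add: cubic_factor_def)
    ultimately show False using y assms(1) by auto
  qed
  with y that show thesis by blast
qed

lemma cubic_factor_roots_real_imp:
  assumes "\<And>w :: complex. cubic_factor k l w = 0 \<Longrightarrow> Im w = 0" "k > 0"
  shows "l + k \<ge> 4 \<and> l \<le> 2"
proof -
  define e :: real where "e = real k + real l"
  define g where "g t = t ^ 3 - e * t\<^sup>2 + 2 * real l * t - 4 * (real l - 2)" for t
  obtain r s t :: complex where fac: "\<And>x. x ^ 3 + (- of_real e) * x\<^sup>2 + (2 * of_nat l) * x
      + (- 4 * (of_nat l - 2)) = (x - r) * (x - s) * (x - t)"
    using cubic_factorization by blast
  have cubic_factor: "cubic_factor k l (- 2 - x) = - ((x - r) * (x - s) * (x - t))" for x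
    unfolding fac[symmetric] cubic_factor_eq_cubic by (simp add: e_def algebra_simps)
  have "Im (- 2 - r) = 0" "Im (- 2 - s) = 0" "Im (- 2 - t) = 0"
    by (rule assms(1); simp add: cubic_factor)+
  then obtain a b c :: real where abc: "r = of_real a" "s = of_real b" "t = of_real c"
    by (metis Im_complex_of_real complex_is_Real_iff diff_0_right minus_complex.simps(2) numeral_One
        of_real_Re complex_Im_numeral uminus_complex.simps(2) diff_0 neg_equal_0_iff_equal)
  have g: "g x = (x - a) * (x - b) * (x - c)" for x
  proof -
    have "of_real (g x) = (of_real ((x - a) * (x - b) * (x - c)) :: complex)"
      using fac[of "of_real x"] by (simp add: g_def abc algebra_simps)
    then show ?thesis by (simp only: of_real_eq_iff)
  qed
  \<comment> \<open>Vieta's relations: a monic cubic is determined by its values at 0, 1 and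
    -1.\<close>
  have e1: "a + b + c = e" and e2: "a * b + b * c + c * a = 2 * l" and e3: "a * b * c = 4 * (real l - 2)"
    using g[of 0] g[of 1] g[of "-1"] by (simp_all add: g_def algebra_simps)
  have roots: "g a = 0" "g b = 0" "g c = 0" by (simp_all add: g)
  have newton1: "3 * (2 * real l) \<le> e\<^sup>2"
  proof -
    have "0 \<le> (a - b)\<^sup>2 + (b - c)\<^sup>2 + (c - a)\<^sup>2" by simp
    also have "\<dots> = 2 * (a + b + c)\<^sup>2 - 6 * (a * b + b * c + c * a)" by algebra
    finally show ?thesis unfolding e1 e2 by simp
  qed
  have newton2: "3 * e * (4 * (real l - 2)) \<le> (2 * real l)\<^sup>2"
  proof -
    have "0 \<le> (a * b - b * c)\<^sup>2 + (b * c - c * a)\<^sup>2 + (c * a - a * b)\<^sup>2" by simp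
    also have "\<dots> = 2 * (a * b + b * c + c * a)\<^sup>2 - 6 * (a + b + c) * (a * b * c)" by algebra
    finally show ?thesis unfolding e1 e2 e3 by simp
  qed
  have k: "real k \<ge> 1" using assms(2) by simp
  have l2: "l \<le> 2"
  proof (rule ccontr)
    assume "\<not> l \<le> 2"
    then have l: "real l \<ge> 3" by simp
    \<comment> \<open>As \<open>e\<close> is at least \<open>1 + l\<close>, \<open>newton2\<close>
      reduces to \<open>2l^2 - 3l - 6 <= 0\<close>, false from \<open>l = 3\<close> on.\<close>
    have "3 * (1 + real l) * (4 * (real l - 2)) \<le> 3 * e * (4 * (real l - 2))"
      using l k by (intro mult_right_mono) (auto simp: e_def)
    with newton2 have "3 * (1 + real l) * (4 * (real l - 2)) \<le> (2 * real l)\<^sup>2" by linarith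
    moreover have "3 * real l \<le> real l * real l" using l by (intro mult_right_mono) auto
    ultimately show False using l by (simp add: power2_eq_square algebra_simps)
  qed
  moreover have "l + k \<ge> 4"
  proof (rule ccontr)
    assume small: "\<not> l + k \<ge> 4"
    then have e_le: "e \<le> 3" by (simp add: e_def)
    consider "l = 2" | "l \<le> 1" using l2 by linarith
    then show False
    proof cases
      case 1
      \<comment> \<open>Here \<open>k = 1\<close> is forced, and \<open>newton1\<close> would read
        12 <= 9.\<close>
      then have "e = 3" using small k by (simp add: e_def)
      with newton1 1 show False by (simp add: power2_eq_square)
    next
      case 2
      have neg: "x < 0" if "g x = 0" for x
      proof (rule ccontr)
        assume "\<not> x < 0"
        then have x: "x \<ge> 0" by simp
        have "e * x\<^sup>2 \<le> 3 * x\<^sup>2" using e_le by (intro mult_right_mono) auto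
        \<comment> \<open>On \<open>x >= 0\<close> the minimum of \<open>x^3 - 3x^2\<close> is -4,
          attained at 2; hence the square factor \<open>(x - 2)^2\<close>.\<close>
        moreover have "0 \<le> x ^ 3 - 3 * x\<^sup>2 + 4"
        proof -
          have "0 \<le> (x - 2)\<^sup>2 * (x + 1)" using x by simp
          also have "\<dots> = x ^ 3 - 3 * x\<^sup>2 + 4" by algebra
          finally show ?thesis .
        qed
        moreover have "x ^ 3 - e * x\<^sup>2 + 2 * real l * x - 4 * real l + 8 = 0"
          using that by (simp add: g_def)
        \<comment> \<open>For \<open>l = 0\<close> this reads 4 <= 0; for \<open>l = 1\<close> it
          forces \<open>x = 0\<close>, where \<open>g\<close> is 4.\<close>
        ultimately have "2 * real l * x + 4 - 4 * real l \<le> 0" by linarith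
        moreover from 2 have "l = 0 \<or> l = 1" by auto
        ultimately have "l = 1" "x = 0" using x by auto
        with that show False by (simp add: g_def)
      qed
      have "e > 0" using k by (simp add: e_def)
      with e1 neg[OF roots(1)] neg[OF roots(2)] neg[OF roots(3)] show False by linarith
    qed
  qed
  ultimately show ?thesis by simp
qed

section \<open>Location of the roots\<close>

text \<open>Vertices in the part of size 2 have degree 3, so \<open>r\<close> lies in the part of
  size 3.\<close>

lemma K23_pverts_cases:
  assumes "K\<^bsub>2,3\<^esub> (with_proj H)" "r \<in> pverts H" "out_degree (with_proj H) r = 2"
  obtains b c p q where "distinct [r, b, c, p, q]" "pverts H = {r, b, c, p, q}"
    "parcs H = {p, q} \<times> {r, b, c} \<union> {r, b, c} \<times> {p, q}"
proof -
  obtain U V where UV: "pverts H = U \<union> V" "U \<inter> V = {}" "card U = 2" "card V = 3"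
    "parcs H = U \<times> V \<union> V \<times> U"
    using assms(1) unfolding complete_bipartite_digraph_pair_def by blast
  have "r \<notin> U"
  proof
    assume "r \<in> U"
    then have "out_arcs (with_proj H) r = {r} \<times> V"
      using UV by (auto simp: out_arcs_def)
    then show False
      using assms(3) UV(4) by (simp add: out_degree_def card_cartesian_product)
  qed
  then have "r \<in> V" using assms(2) UV(1) by blast
  have "card (V - {r}) = 2" using \<open>r \<in> V\<close> UV(4) by simp
  then obtain b c where bc: "V - {r} = {b, c}" "b \<noteq> c" by (auto simp: card_2_iff)
  obtain p q where pq: "U = {p, q}" "p \<noteq> q" using UV(3) by (auto simp: card_2_iff)
  have V: "V = {r, b, c}" "r \<noteq> b" "r \<noteq> c" using bc \<open>r \<in> V\<close> by auto
  show thesis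
    by (rule that[of b c p q]) (use UV V bc(2) pq in auto)
qed

lemma poly_permanental_polynomial_K23_starlike:
  fixes H :: "'a pair_pre_digraph" and z :: complex
  assumes "K\<^bsub>2,3\<^esub> (with_proj H)" "r \<in> pverts H" "out_degree (with_proj H) r = 2"
  shows "poly (permanental_polynomial (coalescence H r (starlike_tree k l) Root)) z =
    z * (z ^ 4 + 6 * z\<^sup>2 + 12) * star_value l z ^ k
    + of_nat k * (z\<^sup>2 + 2)\<^sup>2 * star_value l z ^ (k - 1) * z ^ l"
proof -
  obtain b c p q where *: "distinct [r, b, c, p, q]" "pverts H = {r, b, c, p, q}"
    "parcs H = {p, q} \<times> {r, b, c} \<union> {r, b, c} \<times> {p, q}"
    by (rule K23_pverts_cases[OF assms])
  let ?M = "charmat (coalescence H r (starlike_tree k l) Root) z"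
  let ?I = "Inl :: 'a \<Rightarrow> 'a + starlike_vertex"
  have dist: "distinct [?I r, ?I b, ?I c, ?I p, ?I q]"
    using *(1) by simp
  have entries: "?M u v = (if u = v then z else
      if u \<in> {?I p, ?I q} \<longleftrightarrow> v \<in> {?I p, ?I q} then 0 else - 1)"
    if "u \<in> {?I r, ?I b, ?I c, ?I p, ?I q}" "v \<in> {?I r, ?I b, ?I c, ?I p, ?I q}" for u v
    using that *(1) by (auto simp: charmat_simps *(3))
  have K23: "permanent {?I r, ?I b, ?I c, ?I p, ?I q} ?M = z * (z ^ 4 + 6 * z\<^sup>2 + 12)"
    "permanent {?I b, ?I c, ?I p, ?I q} ?M = (z\<^sup>2 + 2)\<^sup>2"
    by (rule permanent_K23[OF dist]; rule entries; assumption)+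
  have minor: "pverts H - {r} = {b, c, p, q}"
    using *(1,2) by auto
  have "finite (pverts H)" by (simp add: *(2))
  from permanent_branches_attached[where H = H and k = k and l = l and z = z,
      OF this assms(2) order_refl]
  show ?thesis
    unfolding poly_permanental_polynomial pverts_coalescence_starlike[OF assms(2)] minor
    unfolding *(2) image_insert image_empty K23 .
qed

text \<open>For \<open>k > 0\<close> both summands share \<open>star_value l z ^ (k - 1)\<close>.
  The remaining \<open>z * star_value l z\<close> of the first one supplies the common
  \<open>z ^ l\<close>.\<close>

lemma poly_permanental_polynomial_K23_starlike_cubic_factor:
  fixes H :: "'a pair_pre_digraph" and z :: complex
  assumes "K\<^bsub>2,3\<^esub> (with_proj H)" "r \<in> pverts H" "out_degree (with_proj H) r = 2" "k > 0"
  shows "poly (permanental_polynomial (coalescence H r (starlike_tree k l) Root)) z =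
    star_value l z ^ (k - 1) * z ^ l * cubic_factor k l (z\<^sup>2)"
proof -
  have k: "star_value l z ^ k = star_value l z ^ (k - 1) * star_value l z"
    using assms(4) by (simp flip: power_Suc2)
  have "z * (z ^ 4 + 6 * z\<^sup>2 + 12) * star_value l z ^ k =
      star_value l z ^ (k - 1) * (z ^ 4 + 6 * z\<^sup>2 + 12) * (z * star_value l z)"
    unfolding k by (simp only: mult_ac)
  then show ?thesis
    unfolding poly_permanental_polynomial_K23_starlike[OF assms(1-3)] star_value_mult cubic_factor_def
    by (simp add: power2_eq_square eval_nat_numeral algebra_simps)
qed

lemma purely_imaginary_imp_square_real:
  assumes "purely_imaginary z"
  shows "Im (z\<^sup>2) = 0"
  using assms by (simp add: purely_imaginary_def power2_eq_square)

theorem theorem3p4: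
  fixes k l :: nat
    and H :: "'a pair_pre_digraph"
    and r\<^sub>1 :: 'a
  assumes "K\<^bsub>2,3\<^esub> (with_proj H)"
    and "r\<^sub>1 \<in> pverts H"
    and "out_degree (with_proj H) r\<^sub>1 = 2"
  shows "(\<forall>z. poly (permanental_polynomial (coalescence H r\<^sub>1 (starlike_tree k l) Root)) z = 0
              \<longrightarrow> purely_imaginary z)
         \<longleftrightarrow> (l + k \<ge> 4 \<and> l \<le> 2)"
    (is "(\<forall>z. poly ?P z = 0 \<longrightarrow> _) \<longleftrightarrow> _")
proof (cases "k = 0")
  case True
  \<comment> \<open>With \<open>k = 0\<close> only the factor of K_{2,3} remains, and
    \<open>w\<close> is a nonreal root of \<open>y^2 + 6y + 12\<close>. The right-hand side fails
    too, as it would need \<open>l >= 4\<close> and \<open>l <= 2\<close>.\<close>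
  define w where "w = Complex (- 3) (sqrt 3)"
  have "(csqrt w) ^ 4 = ((csqrt w)\<^sup>2)\<^sup>2"
    by (simp only: flip: power_mult) simp
  then have "(csqrt w) ^ 4 + 6 * (csqrt w)\<^sup>2 + 12 = w\<^sup>2 + 6 * w + 12"
    by simp
  also have "\<dots> = 0"
    by (simp add: w_def complex_eq_iff power2_eq_square)
  finally have "poly ?P (csqrt w) = 0"
    by (simp add: poly_permanental_polynomial_K23_starlike[OF assms] True)
  moreover have "\<not> purely_imaginary (csqrt w)"
    using purely_imaginary_imp_square_real[of "csqrt w"] by (auto simp: w_def)
  ultimately show ?thesis using True by auto
next
  case False
  then have k: "k > 0" by simp
  note P = poly_permanental_polynomial_K23_starlike_cubic_factor[OF assms k, of l]
  show ?thesis
  proof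
    assume imag: "\<forall>z. poly ?P z = 0 \<longrightarrow> purely_imaginary z"
    \<comment> \<open>Every root of the cubic is the square of a root of the polynomial, and squares
      of purely imaginary numbers are real.\<close>
    have "Im w = 0" if "cubic_factor k l w = 0" for w :: complex
      using imag[rule_format, of "csqrt w"] that purely_imaginary_imp_square_real[of "csqrt w"]
      by (simp add: P)
    then show "l + k \<ge> 4 \<and> l \<le> 2"
      using k by (rule cubic_factor_roots_real_imp)
  next
    assume kl: "l + k \<ge> 4 \<and> l \<le> 2"
    show "\<forall>z. poly ?P z = 0 \<longrightarrow> purely_imaginary z"
    proof (intro allI impI)
      fix z assume "poly ?P z = 0"
      then consider "z = 0" | "star_value l z = 0" | "cubic_factor k l (z\<^sup>2) = 0"
        by (auto simp: P split: if_splits)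
      then have "z = 0 \<or> (\<exists>y \<le> 0. z\<^sup>2 = of_real y)"
      proof cases
        case 2
        then have "z = 0 \<or> z\<^sup>2 = of_real (- real l)"
          using star_value_mult[of z l] by (auto simp: eq_neg_iff_add_eq_0)
        then show ?thesis by (meson neg_le_0_iff_le of_nat_0_le_iff)
      next
        case 3
        with kl show ?thesis by (metis cubic_factor_root_nonpos)
      qed simp
      then show "purely_imaginary z"
        unfolding purely_imaginary_def by (metis Re_zero_of_square zero_complex.simps(1))
    qed
  qed
qed

end
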